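(* Let $G$ be a simple noncomplete graph on $n$ vertices with chromatic number $\kappa(G)$. Then \[ a(G)\leq n-\left\lceil \frac{n}{\kappa(G)}\right\rceil. \]
   Context: $a(G)$ is the second smallest eigenvalue of the Laplacian $L=D-A$ of $G$ ($A$ adjacency matrix, $D$ diagonal degree matrix). *)

theory Defs
  imports
    "Graph_Theory.Kuratowski"
    "Jordan_Normal_Form.Char_Poly"
begin

text \<open>
  A finite simple graph is a \<^const>\<open>graph\<close> of the Graph_Theory library: a finite, loopless,
  symmetric digraph without parallel arcs, in which an undirected edge is a pair of opposite arcs.
  Hence the degree of a vertex is its \<^const>\<open>out_degree\<close>.

  Rows and columns of the matrices are labelled by a list \<open>vs\<close> enumerating the vertices.
\<close>

definition adjacency_mat :: "('a, 'b) pre_digraph \<Rightarrow> 'a list \<Rightarrow> real mat" where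
  "adjacency_mat G vs = mat (length vs) (length vs)
     (\<lambda>(i, j). if vs ! i \<rightarrow>\<^bsub>G\<^esub> vs ! j then 1 else 0)"

definition degree_mat :: "('a, 'b) pre_digraph \<Rightarrow> 'a list \<Rightarrow> real mat" where
  "degree_mat G vs = mat (length vs) (length vs)
     (\<lambda>(i, j). if i = j then real (out_degree G (vs ! i)) else 0)"

definition laplacian_mat :: "('a, 'b) pre_digraph \<Rightarrow> 'a list \<Rightarrow> real mat" where
  "laplacian_mat G vs = degree_mat G vs - adjacency_mat G vs"

text \<open>
  The real eigenvalues in increasing order, each repeated according to its algebraic multiplicity.
  For a symmetric real matrix these are all the eigenvalues.
\<close>
definition sorted_eigenvalues :: "real mat \<Rightarrow> real list" where
  "sorted_eigenvalues A = sorted_list_of_multiset (proots (char_poly A))"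

text \<open>
  Different enumerations of the vertices give permutation-similar Laplacians, so the choice made
  here does not affect the spectrum. The entry at index 1 is the second smallest eigenvalue,
  counted with multiplicity; it is meaningful for graphs with at least two vertices.
\<close>
definition algebraic_connectivity :: "('a, 'b) pre_digraph \<Rightarrow> real" where
  "algebraic_connectivity G =
     sorted_eigenvalues (laplacian_mat G (SOME vs. distinct vs \<and> set vs = verts G)) ! 1"

definition proper_colouring :: "('a, 'b) pre_digraph \<Rightarrow> nat \<Rightarrow> ('a \<Rightarrow> nat) \<Rightarrow> bool" where
  "proper_colouring G k c \<longleftrightarrow>
     c ` verts G \<subseteq> {..<k} \<and> (\<forall>u v. u \<rightarrow>\<^bsub>G\<^esub> v \<longrightarrow> c u \<noteq> c v)"

definition chromatic_number :: "('a, 'b) pre_digraph \<Rightarrow> nat" where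
  "chromatic_number G = (LEAST k. \<exists>c. proper_colouring G k c)"

lemma chromatic_number_attained:
  assumes "graph G"
  shows "\<exists>c. proper_colouring G (chromatic_number G) c"
proof -
  interpret graph G by fact
  obtain c where c: "bij_betw c (verts G) {0..<card (verts G)}"
    using ex_bij_betw_finite_nat[OF finite_verts] by blast
  have "c u \<noteq> c v" if "u \<rightarrow>\<^bsub>G\<^esub> v" for u v
  proof -
    have "u \<noteq> v" "u \<in> verts G" "v \<in> verts G"
      using that adj_not_same[of v] adj_in_verts[OF that] by auto
    then show ?thesis
      using c by (auto simp: bij_betw_def inj_on_def)
  qed
  then have "proper_colouring G (card (verts G)) c"
    using c by (auto simp: proper_colouring_def bij_betw_def)
  then show ?thesis
    unfolding chromatic_number_def by (intro LeastI) blast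
qed

end

theory Submission
  imports Defs "Jordan_Normal_Form.Schur_Decomposition"
begin

text \<open>
  A graph with two distinct nonadjacent vertices has a colouring with \<open>n - 1\<close> colours, so
  \<open>n / \<kappa>(G) > 1\<close> and by pigeonhole an optimal colouring has a colour class \<open>S\<close> with
  \<open>|S| \<ge> \<lceil>n / \<kappa>(G)\<rceil> \<ge> 2\<close>. Choose distinct \<open>u, v \<in> S\<close>. Since \<open>S\<close> is independent, \<open>u\<close> and \<open>v\<close>
  are nonadjacent of degree at most \<open>n - |S|\<close>. On the plane spanned by the all-ones vector
  (which lies in the kernel of the Laplacian) and \<open>e\<^sub>u - e\<^sub>v\<close>, the Rayleigh quotient is at most
  \<open>(d(u) + d(v)) / 2 \<le> n - |S|\<close>, and by Courant--Fischer this bounds the second smallest eigenvalue.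
\<close>

section \<open>Spectral theorem for real symmetric matrices\<close>

lemma symmetric_mat_scalar_prod_swap:
  fixes A :: "'a :: comm_semiring_0 mat"
  assumes "A \<in> carrier_mat n n" "transpose_mat A = A" "x \<in> carrier_vec n" "y \<in> carrier_vec n"
  shows "(A *\<^sub>v y) \<bullet> x = y \<bullet> (A *\<^sub>v x)"
  using transpose_vec_mult_scalar[OF assms(1,3,4)] assms(2) by simp

text \<open>Over the complex numbers the matrix is Hermitian: moving it across the inner product of
  an eigenvector \<open>v\<close> with itself gives k |v|^2 = cnj k |v|^2, and |v|^2 is
  nonzero.\<close>

lemma eigenvalue_symmetric_real_mat:
  fixes A :: "real mat"
  assumes A: "A \<in> carrier_mat n n" and sym: "transpose_mat A = A"
    and ev: "eigenvalue (map_mat complex_of_real A) k"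
  shows "k \<in> \<real>"
proof -
  let ?M = "map_mat complex_of_real A"
  have M: "?M \<in> carrier_mat n n" using A by simp
  have symM: "transpose_mat ?M = ?M"
    by (subst (2) sym[symmetric]) (simp add: map_mat_transpose)
  obtain v where v: "v \<in> carrier_vec n" and v0: "v \<noteq> 0\<^sub>v n" and Mv: "?M *\<^sub>v v = k \<cdot>\<^sub>v v"
    using ev A unfolding eigenvalue_def eigenvector_def by auto
  have cv: "conjugate v \<in> carrier_vec n" using v by simp
  \<comment> \<open>The entries of \<open>?M\<close> are real, so conjugation commutes with
    multiplication by it.\<close>
  have "?M *\<^sub>v conjugate v = conjugate (?M *\<^sub>v v)"
    using A v by (intro eq_vecI) (auto simp: scalar_prod_def)
  also have "\<dots> = conjugate k \<cdot>\<^sub>v conjugate v"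
    unfolding Mv by (intro eq_vecI) auto
  finally have Mcv: "?M *\<^sub>v conjugate v = conjugate k \<cdot>\<^sub>v conjugate v" .
  have "k * (v \<bullet>c v) = (?M *\<^sub>v v) \<bullet>c v"
    unfolding Mv using v by simp
  also have "\<dots> = v \<bullet> (?M *\<^sub>v conjugate v)"
    by (rule symmetric_mat_scalar_prod_swap[OF M symM cv v])
  also have "\<dots> = conjugate k * (v \<bullet>c v)"
    unfolding Mcv using v by simp
  finally have "k = conjugate k"
    using v v0 by simp
  then show ?thesis
    by (simp add: Reals_cnj_iff)
qed

text \<open>The polynomial splits over the complex numbers and its roots are eigenvalues, hence
  real. The factorization therefore descends to the reals, because the embedding of polynomials is
  injective.\<close>

lemma char_poly_symmetric_real_mat_splits:
  fixes A :: "real mat"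
  assumes A: "A \<in> carrier_mat n n" and sym: "transpose_mat A = A"
  shows "\<exists>es. char_poly A = (\<Prod>e\<leftarrow>es. [:- e, 1:])"
proof -
  interpret poly_hom: map_poly_inj_comm_ring_hom complex_of_real ..
  let ?M = "map_mat complex_of_real A"
  have M: "?M \<in> carrier_mat n n" using A by simp
  obtain ks where ks: "char_poly ?M = (\<Prod>k\<leftarrow>ks. [:- k, 1:])"
    using char_poly_factorized[OF M] by blast
  have "complex_of_real (Re k) = k" if "k \<in> set ks" for k
  proof -
    have "poly (char_poly ?M) k = 0"
      unfolding ks poly_prod_list using that by (auto simp: prod_list_zero_iff)
    then show ?thesis
      using eigenvalue_symmetric_real_mat[OF A sym] eigenvalue_root_char_poly[OF M]
      by (simp add: complex_is_Real_iff complex_eq_iff)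
  qed
  then have "map (\<lambda>k. [:- k, 1:]) ks = map (\<lambda>k. map_poly complex_of_real [:- Re k, 1:]) ks"
    by (auto simp: map_poly_pCons)
  then have "map_poly complex_of_real (char_poly A)
      = (\<Prod>k\<leftarrow>ks. map_poly complex_of_real [:- Re k, 1:])"
    using ks of_real_hom.char_poly_hom[OF A] by metis
  also have "\<dots> = map_poly complex_of_real (\<Prod>e\<leftarrow>map Re ks. [:- e, 1:])"
    by (simp add: poly_hom.hom_prod_list o_def)
  finally have "char_poly A = (\<Prod>e\<leftarrow>map Re ks. [:- e, 1:])"
    using poly_hom.injectivity by blast
  then show ?thesis by blast
qed

text \<open>Complete \<open>v\<close> to a basis, orthogonalize by Gram-Schmidt, which keeps the
  first vector, and normalize the columns. The scalar \<open>c\<close> is the normalization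
  1/|v|.\<close>

lemma ex_orthonormal_mat_with_first_col:
  fixes v :: "real vec"
  assumes v: "v \<in> carrier_vec n" and v0: "v \<noteq> 0\<^sub>v n"
  obtains W c where "W \<in> carrier_mat n n" "transpose_mat W * W = 1\<^sub>m n" "col W 0 = c \<cdot>\<^sub>v v"
proof -
  define b where "b = basis_completion v"
  define ws where "ws = gram_schmidt n b"
  interpret cof_vec_space n "TYPE(real)" .
  have n: "n \<noteq> 0" using v v0 by (metis carrier_vecD eq_vecI index_zero_vec(2) not_less_zero)
  note b = basis_completion[OF v v0, folded b_def]
  obtain vs where bv: "b = v # vs" using b(6,7) n by (cases b) auto
  have ws: "corthogonal ws" "set ws \<subseteq> carrier_vec n" "length ws = n"
    using gram_schmidt_result[OF b(2,4,5) refl] b(6) by (auto simp: ws_def)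
  have ws0: "ws ! 0 = v"
    using gram_schmidt_hd[OF v, of vs] ws(3) n unfolding ws_def bv
    by (metis hd_conv_nth length_0_conv)
  have wi: "ws ! i \<in> carrier_vec n" if "i < n" for i
    using ws that by auto
  define c where "c i = 1 / sqrt (ws ! i \<bullet> ws ! i)" for i
  define W where "W = mat_of_cols n (map (\<lambda>i. c i \<cdot>\<^sub>v ws ! i) [0..<n])"
  have W: "W \<in> carrier_mat n n"
    using mat_of_cols_carrier(1)[of n "map (\<lambda>i. c i \<cdot>\<^sub>v ws ! i) [0..<n]"] by (simp add: W_def)
  have col: "col W i = c i \<cdot>\<^sub>v ws ! i" if "i < n" for i
    unfolding W_def using that wi by (subst col_mat_of_cols) auto
  have pos: "ws ! i \<bullet> ws ! i > 0" if "i < n" for i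
  proof -
    \<comment> \<open>\<open>corthogonal\<close> only says that the self-product is nonzero; being a
      sum of squares makes it positive, so the square root can be divided by.\<close>
    have "ws ! i \<bullet> ws ! i \<noteq> 0" using corthogonalD[OF ws(1), of i i] that ws(3) by simp
    moreover have "ws ! i \<bullet> ws ! i \<ge> 0" by (simp add: scalar_prod_def sum_nonneg)
    ultimately show ?thesis by linarith
  qed
  have "transpose_mat W * W = 1\<^sub>m n"
  proof (rule eq_matI)
    fix i j assume ij: "i < dim_row (1\<^sub>m n :: real mat)" "j < dim_col (1\<^sub>m n :: real mat)"
    then have "(transpose_mat W * W) $$ (i, j) = c i * c j * (ws ! i \<bullet> ws ! j)"
      using W wi[of i] wi[of j] by (simp add: col)
    also have "\<dots> = (if i = j then 1 else 0)"
      using ij corthogonalD[OF ws(1), of i j] ws(3) pos[of i]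
      by (auto simp: c_def)
    finally show "(transpose_mat W * W) $$ (i, j) = (1\<^sub>m n :: real mat) $$ (i, j)"
      using ij by simp
  qed (use W in auto)
  moreover have "col W 0 = c 0 \<cdot>\<^sub>v v" using col[of 0] n ws0 by simp
  ultimately show ?thesis using that W by blast
qed

lemma orthonormal_mat_inverse:
  fixes W :: "real mat"
  assumes "W \<in> carrier_mat n n" "transpose_mat W * W = 1\<^sub>m n"
  shows "W * transpose_mat W = 1\<^sub>m n"
  using mat_mult_left_right_inverse[of "transpose_mat W" n W] assms by simp

lemma char_poly_orthonormal_conjugate:
  fixes A W :: "real mat"
  assumes A: "A \<in> carrier_mat n n" and W: "W \<in> carrier_mat n n"
    and orth: "transpose_mat W * W = 1\<^sub>m n"
  shows "char_poly (transpose_mat W * A * W) = char_poly A"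
  by (rule char_poly_similar, rule similar_matI[where P = "transpose_mat W" and Q = W and n = n])
    (use A W orth orthonormal_mat_inverse[OF W orth] in auto)

text \<open>Deflation: an orthonormal basis starting with an eigenvector for \<open>e\<close> splits
  off a 1x1 block, and the induction hypothesis diagonalizes the remaining symmetric block. The
  order of \<open>es\<close> is arbitrary, so the diagonal can later be taken in increasing
  order.\<close>

lemma real_spectral_theorem:
  fixes A :: "real mat"
  assumes "A \<in> carrier_mat n n" "transpose_mat A = A"
    and "char_poly A = (\<Prod>e\<leftarrow>es. [:- e, 1:])"
  shows "\<exists>P \<in> carrier_mat n n. transpose_mat P * P = 1\<^sub>m n \<and>
           transpose_mat P * A * P = mat_diag n (\<lambda>i. es ! i)"
  using assms
proof (induction es arbitrary: n A)
  case Nil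
  \<comment> \<open>The empty product is 1, whose degree must be \<open>n\<close>.\<close>
  then have "n = 0" using degree_monic_char_poly[of A n] by simp
  then show ?case using Nil.prems by (intro bexI[of _ "1\<^sub>m 0"]) (auto simp: mat_diag_def intro!: eq_matI)
next
  case (Cons e es n A)
  note A = Cons.prems(1) and sym = Cons.prems(2)
  have cp: "char_poly A = [:- e, 1:] * (\<Prod>e\<leftarrow>es. [:- e, 1:])"
    using Cons.prems(3) by simp
  have "eigenvalue A e" unfolding eigenvalue_root_char_poly[OF A] cp by simp
  then obtain v where v: "v \<in> carrier_vec n" and v0: "v \<noteq> 0\<^sub>v n" and Av: "A *\<^sub>v v = e \<cdot>\<^sub>v v"
    using A unfolding eigenvalue_def eigenvector_def by auto
  then obtain m where n: "n = Suc m"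
    by (metis carrier_vecD eq_vecI index_zero_vec(2) not0_implies_Suc not_less_zero)
  obtain W c where W: "W \<in> carrier_mat n n" and orth: "transpose_mat W * W = 1\<^sub>m n"
    and W0: "col W 0 = c \<cdot>\<^sub>v v"
    using ex_orthonormal_mat_with_first_col[OF v v0] .
  let ?B = "transpose_mat W * A * W"
  have B: "?B \<in> carrier_mat n n" using A W by simp
  have symB: "transpose_mat ?B = ?B"
    using A W sym transpose_mult[of "transpose_mat W * A" n n W n] transpose_mult[of "transpose_mat W" n n A n]
    by (simp add: assoc_mult_mat[of _ n n _ n _ n])
  have AW0: "A *\<^sub>v col W 0 = e \<cdot>\<^sub>v col W 0"
    unfolding W0 using A v Av by (simp add: mult_mat_vec smult_smult_assoc mult.commute)
  \<comment> \<open>The first column of \<open>?B\<close> is \<open>e\<close> times the first column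
    of \<open>transpose_mat W * W\<close>, the identity; symmetry then gives the first row.\<close>
  have B0: "?B $$ (i, 0) = (if i = 0 then e else 0)" if i: "i < n" for i
  proof -
    have "?B $$ (i, 0) = (transpose_mat W * (A * W)) $$ (i, 0)"
      using A W by (simp add: assoc_mult_mat[of _ n n _ n _ n])
    also have "\<dots> = col W i \<bullet> (A *\<^sub>v col W 0)"
      using A W i n by (simp add: mult_mat_vec_def)
    also have "\<dots> = e * (transpose_mat W * W) $$ (i, 0)"
      unfolding AW0 using W i n by simp
    finally show ?thesis unfolding orth using i n by simp
  qed
  have B0': "?B $$ (0, i) = (if i = 0 then e else 0)" if i: "i < n" for i
    using B0[OF i] symB B i n by (metis carrier_matD index_transpose_mat(1) zero_less_Suc)
  obtain B1 B2 B3 C where spl: "split_block ?B 1 1 = (B1, B2, B3, C)"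
    by (metis prod_cases4)
  note blk = split_block[OF spl, of m m]
  have dimB: "dim_row ?B = 1 + m" "dim_col ?B = 1 + m" using B n by auto
  have C: "C \<in> carrier_mat m m" using blk dimB by auto
  define E where "E = mat 1 1 (\<lambda>_. e)"
  have E: "E \<in> carrier_mat 1 1" unfolding E_def by simp
  have parts: "B1 = E" "B2 = 0\<^sub>m 1 m" "B3 = 0\<^sub>m m 1"
    using spl dimB B0 B0' n unfolding split_block_def Let_def E_def
    by (auto intro!: eq_matI)
  have Bblk: "?B = four_block_mat E (0\<^sub>m 1 m) (0\<^sub>m m 1) C"
    using blk(5) dimB unfolding parts by simp
  have symC: "transpose_mat C = C"
  proof (rule eq_matI)
    fix i j assume ij: "i < dim_row C" "j < dim_col C"
    have "?B $$ (Suc j, Suc i) = ?B $$ (Suc i, Suc j)"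
      using ij C symB B n by (metis Suc_less_eq carrier_matD index_transpose_mat(1))
    then show "transpose_mat C $$ (i, j) = C $$ (i, j)"
      unfolding Bblk using ij C E by simp
  qed (use C in auto)
  have "char_poly A = char_poly E * char_poly C"
    using char_poly_orthonormal_conjugate[OF A W orth] char_poly_four_block_zeros_col[OF E _ C, of "0\<^sub>m 1 m"]
    unfolding Bblk by simp
  moreover have "char_poly E = [:- e, 1:]"
    unfolding E_def char_poly_defs by (subst det_single) auto
  \<comment> \<open>The common factor for \<open>e\<close> is cancelled; deleting
    \<open>mult_pCons_left\<close> keeps the simplifier from expanding it first.\<close>
  ultimately have "char_poly C = (\<Prod>e\<leftarrow>es. [:- e, 1:])"
    unfolding cp by (simp del: mult_pCons_left)
  then obtain Q where Q: "Q \<in> carrier_mat m m" "transpose_mat Q * Q = 1\<^sub>m m"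
    and QCQ: "transpose_mat Q * C * Q = mat_diag m (\<lambda>i. es ! i)"
    using Cons.IH[OF C symC] by blast
  \<comment> \<open>Bordering \<open>Q\<close> by 1 leaves the split-off eigenvector fixed and
    diagonalizes \<open>C\<close>.\<close>
  let ?Q = "four_block_mat (1\<^sub>m 1) (0\<^sub>m 1 m) (0\<^sub>m m 1) Q"
  have Q': "?Q \<in> carrier_mat n n" using four_block_carrier_mat[of "1\<^sub>m 1" 1 1 Q m m] Q(1) n by simp
  have tQ: "transpose_mat ?Q = four_block_mat (1\<^sub>m 1) (0\<^sub>m 1 m) (0\<^sub>m m 1) (transpose_mat Q)"
    using Q(1) by (subst transpose_four_block_mat[of _ 1 1 _ m _ m]) auto
  have QQ: "transpose_mat ?Q * ?Q = 1\<^sub>m n"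
    unfolding tQ using Q n by (subst mult_four_block_mat[of _ 1 1 _ m _ m _ _ 1 _ m]) auto
  have QBQ: "transpose_mat ?Q * ?B * ?Q = mat_diag n (\<lambda>i. (e # es) ! i)"
  proof -
    have "transpose_mat ?Q * ?B = four_block_mat E (0\<^sub>m 1 m) (0\<^sub>m m 1) (transpose_mat Q * C)"
      unfolding tQ Bblk using Q E C by (subst mult_four_block_mat[of _ 1 1 _ m _ m _ _ 1 _ m]) auto
    then have "transpose_mat ?Q * ?B * ?Q
        = four_block_mat E (0\<^sub>m 1 m) (0\<^sub>m m 1) (transpose_mat Q * C * Q)"
      using Q E C by (simp, subst mult_four_block_mat[of _ 1 1 _ m _ m _ _ 1 _ m]) auto
    also have "\<dots> = mat_diag n (\<lambda>i. (e # es) ! i)"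
      unfolding QCQ n mat_diag_def E_def by (rule eq_matI) (auto simp: nth_Cons')
    finally show ?thesis .
  qed
  \<comment> \<open>\<open>R\<close> is \<open>?Q\<close> with its block form forgotten, so that the
    products below stay abstract.\<close>
  obtain R where R: "R \<in> carrier_mat n n" "transpose_mat R * R = 1\<^sub>m n"
    and RBR: "transpose_mat R * ?B * R = mat_diag n (\<lambda>i. (e # es) ! i)"
    using Q' QQ QBQ by blast
  have tR: "transpose_mat R \<in> carrier_mat n n" using R(1) by simp
  have tr: "transpose_mat (W * R) = transpose_mat R * transpose_mat W"
    by (rule transpose_mult[OF W R(1)])
  show ?case
  proof (intro bexI conjI)
    show "W * R \<in> carrier_mat n n" using W R(1) by simp
    have "transpose_mat (W * R) * (W * R) = transpose_mat R * (transpose_mat W * W) * R"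
      unfolding tr using W R(1) by (simp add: assoc_mult_mat[of _ n n _ n _ n])
    then show "transpose_mat (W * R) * (W * R) = 1\<^sub>m n"
      unfolding orth right_mult_one_mat[OF tR] R(2) .
    have "transpose_mat (W * R) * A * (W * R) = transpose_mat R * ?B * R"
      unfolding tr using W R(1) A by (simp add: assoc_mult_mat[of _ n n _ n _ n])
    then show "transpose_mat (W * R) * A * (W * R) = mat_diag n (\<lambda>i. (e # es) ! i)"
      unfolding RBR .
  qed
qed

section \<open>Ordered spectrum and a Courant-Fischer bound\<close>

lemma sorted_eigenvalues_symmetric:
  fixes A :: "real mat"
  assumes A: "A \<in> carrier_mat n n" and sym: "transpose_mat A = A"
  shows "char_poly A = (\<Prod>e\<leftarrow>sorted_eigenvalues A. [:- e, 1:])"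
    and "length (sorted_eigenvalues A) = n"
    and "sorted (sorted_eigenvalues A)"
proof -
  obtain es where es: "char_poly A = (\<Prod>e\<leftarrow>es. [:- e, 1:])"
    using char_poly_symmetric_real_mat_splits[OF assms] by blast
  \<comment> \<open>For a product of linear factors \<open>proots\<close> returns every factor's
    root with multiplicity, so the sorted list misses no eigenvalue and has length
    \<open>n\<close>.\<close>
  have "proots (\<Prod>e\<leftarrow>es. [:- e, 1:]) = mset es"
  proof (induction es)
    case (Cons e es)
    have "(\<Prod>e\<leftarrow>es. [:- e, 1:]) \<noteq> 0" by auto
    then have "proots ([:- e, 1:] * (\<Prod>e\<leftarrow>es. [:- e, 1:])) = {#e#} + mset es"
      using Cons.IH by (subst proots_mult) auto
    then show ?case by simp
  qed simp
  then have eq: "mset (sorted_eigenvalues A) = mset es"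
    unfolding sorted_eigenvalues_def es by simp
  have "(\<Prod>e\<leftarrow>sorted_eigenvalues A. [:- e, 1:]) = (\<Prod>e\<leftarrow>es. [:- e, 1:])"
    using eq by (metis mset_map prod_mset_prod_list)
  then show *: "char_poly A = (\<Prod>e\<leftarrow>sorted_eigenvalues A. [:- e, 1:])"
    using es by simp
  show "length (sorted_eigenvalues A) = n"
    using degree_monic_char_poly[OF A] degree_linear_factors[of uminus "sorted_eigenvalues A"] * by simp
  show "sorted (sorted_eigenvalues A)"
    unfolding sorted_eigenvalues_def by simp
qed

text \<open>The plane spanned by \<open>x\<close> and \<open>y\<close> contains a nonzero vector orthogonal to the first eigenvector.\<close>
lemma second_eigenvalue_le:
  fixes A :: "real mat"
  assumes A: "A \<in> carrier_mat n n" and sym: "transpose_mat A = A" and n: "2 \<le> n"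
    and x: "x \<in> carrier_vec n" and y: "y \<in> carrier_vec n"
    and plane: "\<And>a b w. w = a \<cdot>\<^sub>v x + b \<cdot>\<^sub>v y \<Longrightarrow> (a, b) \<noteq> (0, 0) \<Longrightarrow>
      w \<bullet> w > 0 \<and> w \<bullet> (A *\<^sub>v w) \<le> \<mu> * (w \<bullet> w)"
  shows "sorted_eigenvalues A ! 1 \<le> \<mu>"
proof -
  define es where "es = sorted_eigenvalues A"
  note es = sorted_eigenvalues_symmetric[OF A sym, folded es_def]
  obtain P where P: "P \<in> carrier_mat n n" and orth: "transpose_mat P * P = 1\<^sub>m n"
    and diag: "transpose_mat P * A * P = mat_diag n (\<lambda>i. es ! i)"
    using real_spectral_theorem[OF A sym es(1)] by blast
  note PP = orthonormal_mat_inverse[OF P orth]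
  \<comment> \<open>One homogeneous linear equation in two unknowns has a nontrivial solution; it
    makes \<open>w\<close> orthogonal to \<open>col P 0\<close>, the eigenvector for the smallest
    eigenvalue.\<close>
  obtain a b where ab: "(a, b) \<noteq> (0, 0)" "a * (col P 0 \<bullet> x) + b * (col P 0 \<bullet> y) = 0"
  proof (cases "col P 0 \<bullet> y = 0")
    case True
    then show ?thesis using that[of 0 1] by simp
  next
    case False
    then show ?thesis using that[of "col P 0 \<bullet> y" "- (col P 0 \<bullet> x)"] by simp
  qed
  define w where "w = a \<cdot>\<^sub>v x + b \<cdot>\<^sub>v y"
  have w: "w \<in> carrier_vec n" unfolding w_def using x y by simp
  \<comment> \<open>The coordinates of \<open>w\<close> in the eigenbasis: norms are preserved, the
    quadratic form becomes diagonal, and coordinate 0 vanishes.\<close>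
  define z where "z = transpose_mat P *\<^sub>v w"
  have z: "z \<in> carrier_vec n" unfolding z_def using P w by simp
  have "col P 0 \<in> carrier_vec n" using P n by (intro col_carrier_vec) auto
  then have "col P 0 \<bullet> w = 0"
    unfolding w_def using x y ab(2) by (simp add: scalar_prod_add_distrib[of _ n])
  then have z0: "z $ 0 = 0" unfolding z_def using P n by simp
  have wz: "w = P *\<^sub>v z"
    unfolding z_def using P w PP by (simp flip: assoc_mult_mat_vec[of _ n n _ n])
  have tP: "transpose_mat P \<in> carrier_mat n n" using P by simp
  have trans: "(P *\<^sub>v z) \<bullet> u = z \<bullet> (transpose_mat P *\<^sub>v u)" if "u \<in> carrier_vec n" for u
    using transpose_vec_mult_scalar[OF tP that z] by simp
  have "w \<bullet> w = z \<bullet> z"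
    using trans[OF w] unfolding z_def[symmetric] wz[symmetric] .
  also have "\<dots> = (\<Sum>i<n. (z $ i)\<^sup>2)"
    using z by (simp add: scalar_prod_def power2_eq_square lessThan_atLeast0)
  finally have ww: "w \<bullet> w = (\<Sum>i<n. (z $ i)\<^sup>2)" .
  have "w \<bullet> (A *\<^sub>v w) = z \<bullet> (transpose_mat P *\<^sub>v (A *\<^sub>v w))"
    using trans[of "A *\<^sub>v w"] A w wz by simp
  also have "transpose_mat P *\<^sub>v (A *\<^sub>v w) = (transpose_mat P * A * P) *\<^sub>v z"
    using A P z wz by (simp add: assoc_mult_mat_vec[of _ n n _ n])
  also have "\<dots> = vec n (\<lambda>i. es ! i * z $ i)"
    unfolding diag mat_diag_def using z
    by (intro eq_vecI) (auto simp: scalar_prod_def if_distrib[where f = "\<lambda>t. t * _"] cong: if_cong)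
  also have "z \<bullet> \<dots> = (\<Sum>i<n. es ! i * (z $ i)\<^sup>2)"
    by (simp add: scalar_prod_def power2_eq_square lessThan_atLeast0 mult.left_commute)
  finally have wAw: "w \<bullet> (A *\<^sub>v w) = (\<Sum>i<n. es ! i * (z $ i)\<^sup>2)" .
  \<comment> \<open>Only indices from 1 on contribute, and there the sorted eigenvalues are at least
    \<open>es ! 1\<close>.\<close>
  have "es ! 1 * (w \<bullet> w) \<le> w \<bullet> (A *\<^sub>v w)"
    unfolding ww wAw sum_distrib_left
  proof (rule sum_mono)
    fix i assume i: "i \<in> {..<n}"
    show "es ! 1 * (z $ i)\<^sup>2 \<le> es ! i * (z $ i)\<^sup>2"
    proof (cases "i = 0")
      case True
      then show ?thesis using z0 by simp
    next
      case False
      then have "es ! 1 \<le> es ! i" using es(2,3) i by (intro sorted_nth_mono) auto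
      then show ?thesis by (simp add: mult_right_mono)
    qed
  qed
  also have "\<dots> \<le> \<mu> * (w \<bullet> w)" using plane[OF w_def ab(1)] by simp
  finally show ?thesis
    using plane[OF w_def ab(1)] unfolding es_def by (simp add: mult_le_cancel_right)
qed

section \<open>The graph Laplacian and its test plane\<close>

lemma (in graph) out_degree_eq_card_successors: "out_degree G u = card {v. u \<rightarrow>\<^bsub>G\<^esub> v}"
proof -
  \<comment> \<open>\<open>out_degree\<close> counts arcs; without parallel arcs, an arc leaving
    \<open>u\<close> is determined by its head.\<close>
  have "inj_on (head G) (out_arcs G u)"
    by (rule inj_onI) (auto intro: no_multi_arcs simp: arc_to_ends_def)
  moreover have "head G ` out_arcs G u = {v. u \<rightarrow>\<^bsub>G\<^esub> v}"
    by (auto simp: arcs_ends_def arc_to_ends_def image_iff)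
  ultimately show ?thesis
    unfolding out_degree_def by (metis card_image)
qed

lemma laplacian_mat_dim [simp]:
  "dim_row (laplacian_mat G vs) = length vs" "dim_col (laplacian_mat G vs) = length vs"
  by (simp_all add: laplacian_mat_def degree_mat_def adjacency_mat_def)

lemma laplacian_mat_index:
  assumes "i < length vs" "j < length vs"
  shows "laplacian_mat G vs $$ (i, j) =
    (if i = j then real (out_degree G (vs ! i)) else 0) - (if vs ! i \<rightarrow>\<^bsub>G\<^esub> vs ! j then 1 else 0)"
  using assms by (simp add: laplacian_mat_def degree_mat_def adjacency_mat_def)

lemma (in graph) laplacian_mat_symmetric:
  "transpose_mat (laplacian_mat G vs) = laplacian_mat G vs"
proof (rule eq_matI)
  fix i j assume "i < dim_row (laplacian_mat G vs)" "j < dim_col (laplacian_mat G vs)"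
  then show "transpose_mat (laplacian_mat G vs) $$ (i, j) = laplacian_mat G vs $$ (i, j)"
    using graph_symmetric by (auto simp: laplacian_mat_index)
qed simp_all

text \<open>Each row sums to the degree minus the number of neighbours. As \<open>vs\<close> lists
  every vertex exactly once, neighbours can be counted by their indices.\<close>

lemma (in graph) laplacian_mat_mult_ones:
  assumes vs: "distinct vs" "set vs = verts G"
  shows "laplacian_mat G vs *\<^sub>v vec (length vs) (\<lambda>_. 1) = 0\<^sub>v (length vs)"
proof (rule eq_vecI)
  let ?n = "length vs"
  fix i assume "i < dim_vec (0\<^sub>v ?n :: real vec)"
  then have i: "i < ?n" by simp
  have "{v. vs ! i \<rightarrow>\<^bsub>G\<^esub> v} = (\<lambda>j. vs ! j) ` {j. j < ?n \<and> vs ! i \<rightarrow>\<^bsub>G\<^esub> vs ! j}"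
  proof
    show "{v. vs ! i \<rightarrow>\<^bsub>G\<^esub> v} \<subseteq> (\<lambda>j. vs ! j) ` {j. j < ?n \<and> vs ! i \<rightarrow>\<^bsub>G\<^esub> vs ! j}"
    proof
      fix v assume "v \<in> {v. vs ! i \<rightarrow>\<^bsub>G\<^esub> v}"
      then have v: "vs ! i \<rightarrow>\<^bsub>G\<^esub> v" by simp
      then obtain j where "j < ?n" "v = vs ! j"
        using adj_in_verts(2) vs(2) by (metis in_set_conv_nth)
      then show "v \<in> (\<lambda>j. vs ! j) ` {j. j < ?n \<and> vs ! i \<rightarrow>\<^bsub>G\<^esub> vs ! j}"
        using v by blast
    qed
  qed auto
  moreover have "inj_on (\<lambda>j. vs ! j) {j. j < ?n \<and> vs ! i \<rightarrow>\<^bsub>G\<^esub> vs ! j}"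
    using vs(1) by (auto simp: inj_on_def nth_eq_iff_index_eq)
  ultimately have deg: "out_degree G (vs ! i) = card {j. j < ?n \<and> vs ! i \<rightarrow>\<^bsub>G\<^esub> vs ! j}"
    by (simp add: out_degree_eq_card_successors card_image)
  have "(laplacian_mat G vs *\<^sub>v vec ?n (\<lambda>_. 1)) $ i = (\<Sum>j<?n. laplacian_mat G vs $$ (i, j))"
    using i by (simp add: scalar_prod_def lessThan_atLeast0)
  also have "\<dots> = real (out_degree G (vs ! i)) - (\<Sum>j<?n. if vs ! i \<rightarrow>\<^bsub>G\<^esub> vs ! j then 1 else 0)"
    using i by (simp add: laplacian_mat_index sum_subtractf)
  also have "\<dots> = 0"
    unfolding deg by (simp add: sum.If_cases Int_def)
  finally show "(laplacian_mat G vs *\<^sub>v vec ?n (\<lambda>_. 1)) $ i = 0\<^sub>v ?n $ i"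
    using i by simp
qed simp

text \<open>With \<open>x\<close> the difference of the unit vectors at \<open>u\<close> and
  \<open>v\<close>, a vector \<open>a\<close> times ones plus \<open>b\<close> times
  \<open>x\<close> has squared norm a^2 n + 2 b^2, while its Laplacian form is b^2 (d(u) +
  d(v)).\<close>

lemma (in graph) algebraic_connectivity_le_nonadjacent_degrees:
  assumes u: "u \<in> verts G" and v: "v \<in> verts G" and uv: "u \<noteq> v" "\<not> u \<rightarrow>\<^bsub>G\<^esub> v"
  shows "algebraic_connectivity G \<le> (real (out_degree G u) + real (out_degree G v)) / 2"
proof -
  define vs where "vs = (SOME vs. distinct vs \<and> set vs = verts G)"
  have "\<exists>vs. distinct vs \<and> set vs = verts G"
    using finite_distinct_list[OF finite_verts] by blast
  then have vs: "distinct vs" "set vs = verts G"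
    unfolding vs_def by (metis (mono_tags, lifting) someI_ex)+
  define n where "n = length vs"
  define L where "L = laplacian_mat G vs"
  have L: "L \<in> carrier_mat n n" unfolding L_def n_def by (simp add: carrier_matI)
  have sym: "transpose_mat L = L" unfolding L_def by (rule laplacian_mat_symmetric)
  obtain p q where p: "p < n" "vs ! p = u" and q: "q < n" "vs ! q = v"
    using u v vs(2) unfolding n_def by (metis in_set_conv_nth)
  have pq: "p \<noteq> q" using p q uv(1) by auto
  define o1 where "o1 = vec n (\<lambda>_. 1 :: real)"
  define x where "x = unit_vec n p - (unit_vec n q :: real vec)"
  have o1: "o1 \<in> carrier_vec n" and x: "x \<in> carrier_vec n" by (auto simp: o1_def x_def)
  have Lo: "L *\<^sub>v o1 = 0\<^sub>v n"
    unfolding L_def o1_def n_def by (rule laplacian_mat_mult_ones[OF vs])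
  have Lx: "L *\<^sub>v x \<in> carrier_vec n" using L x by simp
  have xy: "x \<bullet> y = y $ p - y $ q" if "y \<in> carrier_vec n" for y
    unfolding x_def using that p q by (simp add: minus_scalar_prod_distrib[of _ n])
  have Lxi: "(L *\<^sub>v x) $ i = L $$ (i, p) - L $$ (i, q)" if "i < n" for i
    unfolding x_def using L that p q by (simp add: scalar_prod_minus_distrib[of _ n])
  have "\<not> v \<rightarrow>\<^bsub>G\<^esub> u" using uv graph_symmetric by blast
  \<comment> \<open>Nonadjacency kills the two mixed entries, and the absence of loops makes the
    diagonal entries the plain degrees.\<close>
  then have xLx: "x \<bullet> (L *\<^sub>v x) = real (out_degree G u) + real (out_degree G v)"
    unfolding xy[OF Lx] Lxi[OF p(1)] Lxi[OF q(1)]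
    using p q pq uv adj_not_same
    \<comment> \<open>Here the four entries of \<open>L\<close> at \<open>p\<close> and
      \<open>q\<close> are evaluated.\<close>
    by (auto simp: L_def laplacian_mat_index n_def)
  have oLx: "o1 \<bullet> (L *\<^sub>v x) = 0"
    using symmetric_mat_scalar_prod_swap[OF L sym x o1] Lo x by simp
  have xx: "x \<bullet> x = 2" unfolding xy[OF x] using p q pq by (simp add: x_def)
  have xo: "x \<bullet> o1 = 0" unfolding xy[OF o1] using p q by (simp add: o1_def)
  have ox: "o1 \<bullet> x = 0" using xo comm_scalar_prod[OF o1 x] by simp
  have oo: "o1 \<bullet> o1 = real n" by (simp add: o1_def scalar_prod_def)
  have n: "2 \<le> n" using p(1) q(1) pq by linarith
  define \<mu> where "\<mu> = (real (out_degree G u) + real (out_degree G v)) / 2"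
  have "sorted_eigenvalues L ! 1 \<le> \<mu>"
  proof (rule second_eigenvalue_le[OF L sym n o1 x])
    fix a b w assume w_def: "w = a \<cdot>\<^sub>v o1 + b \<cdot>\<^sub>v x" and ab: "(a, b) \<noteq> (0, 0)"
    have w: "w \<in> carrier_vec n" unfolding w_def using o1 x by simp
    have lin: "w \<bullet> y = a * (o1 \<bullet> y) + b * (x \<bullet> y)" if "y \<in> carrier_vec n" for y
      unfolding w_def using o1 x that by (simp add: add_scalar_prod_distrib[of _ n])
    have smult_zero: "a \<cdot>\<^sub>v 0\<^sub>v n = 0\<^sub>v n" by (intro eq_vecI) auto
    have "L *\<^sub>v w = b \<cdot>\<^sub>v (L *\<^sub>v x)"
      unfolding w_def using L o1 x Lx smult_zero
      by (simp add: mult_add_distrib_mat_vec[of _ n n] mult_mat_vec[of _ n n] Lo)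
    then have wLw: "w \<bullet> (L *\<^sub>v w) = 2 * \<mu> * b\<^sup>2"
      using lin[OF Lx] w Lx oLx xLx by (simp add: power2_eq_square \<mu>_def)
    have "o1 \<bullet> w = a * real n" "x \<bullet> w = 2 * b"
      unfolding w_def using o1 x oo ox xo xx by (simp_all add: scalar_prod_add_distrib[of _ n])
    then have ww: "w \<bullet> w = a\<^sup>2 * real n + 2 * b\<^sup>2"
      using lin[OF w] by (simp add: power2_eq_square)
    have "0 < a\<^sup>2 * real n + 2 * b\<^sup>2"
    proof (cases "b = 0")
      case True
      then show ?thesis using ab n by simp
    next
      case False
      then show ?thesis by (simp add: add_nonneg_pos)
    qed
    \<comment> \<open>This is the slack in the Rayleigh bound: the ones direction adds to the norm
      but not to the form.\<close>
    moreover have "0 \<le> \<mu> * (a\<^sup>2 * real n)" by (simp add: \<mu>_def)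
    ultimately show "w \<bullet> w > 0 \<and> w \<bullet> (L *\<^sub>v w) \<le> \<mu> * (w \<bullet> w)"
      unfolding ww wLw by (simp add: algebra_simps)
  qed
  then show ?thesis
    unfolding algebraic_connectivity_def L_def vs_def \<mu>_def .
qed

section \<open>Colourings and independent sets\<close>

lemma (in graph) chromatic_number_less_card_if_nonadjacent:
  assumes u: "u \<in> verts G" and v: "v \<in> verts G" and uv: "u \<noteq> v" "\<not> u \<rightarrow>\<^bsub>G\<^esub> v"
  shows "chromatic_number G < card (verts G)"
proof -
  let ?V = "verts G - {v}"
  obtain c where c: "bij_betw c ?V {0..<card ?V}"
    using ex_bij_betw_finite_nat[of ?V] finite_verts by blast
  \<comment> \<open>All vertices but \<open>v\<close> get distinct colours, and \<open>v\<close>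
    reuses the colour of \<open>u\<close>; no arc joins these two in either direction.\<close>
  define d where "d = c(v := c u)"
  have vu: "\<not> v \<rightarrow>\<^bsub>G\<^esub> u" using uv graph_symmetric by blast
  have "d x \<noteq> d y" if "x \<rightarrow>\<^bsub>G\<^esub> y" for x y
  proof -
    have "x \<in> verts G" "y \<in> verts G" "x \<noteq> y"
      using that adj_in_verts[OF that] adj_not_same[of y] by auto
    then show ?thesis
      using c u uv vu that by (auto simp: d_def bij_betw_def inj_on_def)
  qed
  moreover have "d ` verts G \<subseteq> {..<card ?V}"
    using c u uv by (auto simp: d_def bij_betw_def)
  ultimately have "proper_colouring G (card ?V) d"
    by (simp add: proper_colouring_def)
  then have "chromatic_number G \<le> card ?V"
    unfolding chromatic_number_def by (intro Least_le exI)
  also have "\<dots> < card (verts G)"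
    by (rule card_Diff1_less[OF finite_verts v])
  finally show ?thesis .
qed

lemma ex_large_colour_class:
  assumes fin: "finite V" and c: "c ` V \<subseteq> {..<k}" and k: "0 < k"
  shows "\<exists>i. \<lceil>real (card V) / real k\<rceil> \<le> int (card {x \<in> V. c x = i})"
proof -
  \<comment> \<open>Pigeonhole in product form, free of division: if every class were too small,
    summing over the \<open>k\<close> colours would give
    \<open>k * card V < k * card V\<close>.\<close>
  obtain i where i: "card V \<le> k * card {x \<in> V. c x = i}"
  proof (rule ccontr)
    assume "\<not> thesis"
    then have less: "k * card {x \<in> V. c x = i} < card V" for i
      using that not_le by blast
    have "card V = (\<Sum>i<k. card {x \<in> V. c x = i})"
      using sum.group[OF fin _ c, of "\<lambda>_. 1 :: nat"] by simp
    then have "k * card V = (\<Sum>i<k. k * card {x \<in> V. c x = i})"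
      by (simp add: sum_distrib_left)
    also have "\<dots> < (\<Sum>i<k. card V)"
      using less k by (intro sum_strict_mono) auto
    finally show False by simp
  qed
  then have "real (card V) \<le> real (card {x \<in> V. c x = i}) * real k"
    by (metis mult.commute of_nat_le_iff of_nat_mult)
  then have "real (card V) / real k \<le> real_of_int (int (card {x \<in> V. c x = i}))"
    using k by (simp add: divide_le_eq)
  then show ?thesis
    using ceiling_le by blast
qed

lemma (in graph) out_degree_le_if_independent:
  assumes S: "S \<subseteq> verts G" and ind: "\<And>x. x \<in> S \<Longrightarrow> \<not> u \<rightarrow>\<^bsub>G\<^esub> x"
  shows "out_degree G u \<le> card (verts G) - card S"
proof -
  have "{v. u \<rightarrow>\<^bsub>G\<^esub> v} \<subseteq> verts G - S"
    using ind adj_in_verts by auto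
  then have "out_degree G u \<le> card (verts G - S)"
    unfolding out_degree_eq_card_successors using finite_verts by (intro card_mono) auto
  also have "\<dots> = card (verts G) - card S"
    using S finite_verts by (intro card_Diff_subset) (auto intro: finite_subset)
  finally show ?thesis .
qed

theorem theorem6p1:
  fixes G :: "('a, 'b) pre_digraph" and n :: nat
  assumes "graph G"
    and "card (verts G) = n"
    and "\<not> complete_digraph n G"
  shows "algebraic_connectivity G
    \<le> real n - real_of_int \<lceil>real n / real (chromatic_number G)\<rceil>"
proof -
  interpret graph G by fact
  define k where "k = chromatic_number G"
  \<comment> \<open>Arcs always join distinct vertices of \<open>G\<close>, so the only way to fail
    completeness is a missing pair.\<close>
  obtain x y where "x \<in> verts G" "y \<in> verts G" "x \<noteq> y" "\<not> x \<rightarrow>\<^bsub>G\<^esub> y"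
    using assms adj_in_verts adj_not_same unfolding complete_digraph_def by blast
  then have kn: "k < n" and n0: "verts G \<noteq> {}"
    using chromatic_number_less_card_if_nonadjacent assms(2) unfolding k_def by auto
  obtain c where c: "proper_colouring G k c"
    using chromatic_number_attained[OF assms(1)] unfolding k_def by blast
  have k: "0 < k" using c n0 by (auto simp: proper_colouring_def)
  obtain i where i: "\<lceil>real n / real k\<rceil> \<le> int (card {x \<in> verts G. c x = i})"
    using ex_large_colour_class[OF finite_verts _ k, of c] c assms(2) by (auto simp: proper_colouring_def)
  define S where "S = {x \<in> verts G. c x = i}"
  have S: "S \<subseteq> verts G" "finite S"
    using finite_verts by (auto simp: S_def)
  have ind: "\<not> x \<rightarrow>\<^bsub>G\<^esub> y" if "x \<in> S" "y \<in> S" for x y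
    using c that unfolding S_def proper_colouring_def by fastforce
  \<comment> \<open>A quotient above 1 has ceiling at least 2, which is what provides two vertices
    in the class.\<close>
  have "1 < real n / real k" using k kn by simp
  then have "1 < card S" using i unfolding S_def by linarith
  then obtain u v where uv: "u \<in> S" "v \<in> S" "u \<noteq> v"
    by (metis One_nat_def card_le_Suc0_iff_eq S(2) not_less)
  \<comment> \<open>This rules out truncation in the natural subtraction of the degree bound, so it
    can be restated over the reals.\<close>
  have "card S \<le> n" using S finite_verts assms(2) card_mono by blast
  then have deg: "real (out_degree G w) \<le> real n - real (card S)" if "w \<in> S" for w
    using out_degree_le_if_independent[OF S(1), of w] ind[OF that] assms(2) by fastforce
  have "algebraic_connectivity G \<le> (real (out_degree G u) + real (out_degree G v)) / 2"
    using algebraic_connectivity_le_nonadjacent_degrees uv ind S(1) by blast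
  also have "\<dots> \<le> real n - real (card S)"
    using deg[OF uv(1)] deg[OF uv(2)] by simp
  also have "\<dots> \<le> real n - real_of_int \<lceil>real n / real k\<rceil>"
    using i unfolding S_def by linarith
  finally show ?thesis unfolding k_def .
qed

end
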